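(* Let $\{p_\theta:\theta\in\mathbb{T}\}$ be an invariant statistical model satisfying the Model Assumptions (including A1--A3) given in the context, with $\mathbb{T}=\mathscr{G}=\overline{\mathscr{G}}$. For each fixed $x\in\mathbb{X}$, the fiducial distribution $\mathsf{Q}_x$ is a maximal member of the credal set $\mathscr{C}(\overline{\Pi}_x)$ of the inferential model's possibility measure $\overline{\Pi}_x$; that is, $\mathsf{Q}_x\in\mathscr{C}(\overline{\Pi}_x)$ and $$\mathsf{Q}_x\{\pi_x(\Theta)\le\alpha\}=\alpha\quad\text{for all }\alpha\in[0,1],$$ where, in this display, $\Theta\sim\mathsf{Q}_x$ and $x$ is fixed.
   Context: Setting. $X\in\mathbb{X}$ is observable data with distribution $\mathsf{P}_\theta$, $\theta\in\mathbb{T}$. $\mathscr{G}$ is a locally compact topological group of bijections $g:\mathbb{X}\to\mathbb{X}$, with composition $\circ$; $gx$ denotes the image of $x$. Each $g\in\mathscr{G}$ induces a bijection $\bar g:\mathbb{T}\to\mathbb{T}$, and $\overline{\mathscr{G}}$ is the group of these. It is assumed that $\mathbb{T}=\mathscr{G}=\overline{\mathscr{G}}$, so parameter values $\theta$ are group elements and $\bar g\theta=g\circ\theta$. Each $\mathsf{P}_\theta$ has a density $p_\theta$ with respect to a common $\sigma$-finite measure, and the family is invariant: $p_\theta(x)=p_{\bar g\theta}(gx)\,\chi(g)$ for all $x\in\mathbb{X}$, $\theta\in\mathbb{T}$, $g\in\mathscr{G}$, where $\chi(g)$ is a multiplier (change-of-variables Jacobian). Moreover: A1. The left Haar measure $\lambda$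 and corresponding right Haar measure $\rho$ on the Borel $\sigma$-algebra of $\mathscr{G}$ exist and are unique up to scalar multiples. A2. There is a bijection $t:\mathbb{X}\to\mathscr{G}\times\mathbb{U}$, with $t$ and $t^{-1}$ measurable, mapping $x$ to its position--orbit coordinates $(g_x,u_x)$, where $u_x$ labels the orbit $\mathscr{G}x=\{gx:g\in\mathscr{G}\}$ and $g_x$ is the position of $x$ on that orbit; thus $t(gx)=(g\circ g_x,u_x)$ for all $g\in\mathscr{G}$. A3. The distribution of $t(X)=(G,U)$ induced by $X\sim\mathsf{P}_\theta$ has a density with respect to $\lambda\times\mu$ for some measure $\mu$ on $\mathbb{U}$. Under these assumptions the joint density of $(G,U)$ under $\mathsf{P}_\theta$ has the form $p_\theta(g,u)=f(\theta^{-1}\circ g,u)$ for $(\lambda\times\mu)$-almost all $(g,u)$, for a fixed function $f:\mathscr{G}\times\mathbb{U}\to\mathbb{R}$ not depending on $\theta$. Put $H:=\theta^{-1}\circ G$. Its conditional distribution given $U=u$, when $X\sim\mathsf{P}_\theta$, does not depend on $\theta$; it has $\lambda$-density proportional to $h\mapsto f(h,u)$. Below, $\mathsf{P}(\cdot\mid U=u)$ refers to this conditional distribution. Fiducial distribution. For $x$ with $t(x)=(g,u)$, $\mathsf{Q}_x(A)=\mathsf{P}(g\circ H^{-1}\in A\mid U=u)$ for measurable $A\subseteq\mathbb{T}$. Inferential model. For $x$ with $t(x)=(g,u)$, the possibility contour is $\pi_x(\theta)=\mathsf{P}\{f(H,u)\le f(\theta^{-1}\circ g,u)\mid U=u\}$,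 $\theta\in\mathbb{T}$, and the possibility measure is $\overline{\Pi}_x(A)=\sup_{\theta\in A}\pi_x(\theta)$, $A\subseteq\mathbb{T}$. Credal set and maximality. For a possibility measure $\Pi$ on $\mathbb{Y}$ with contour $\pi$ (so $\Pi(A)=\sup_{y\in A}\pi(y)$), the credal set $\mathscr{C}(\Pi)$ is the set of probability measures $\mathsf{P}$ on $\mathbb{Y}$ with $\mathsf{P}(\cdot)\le\Pi(\cdot)$. A probability measure $\mathsf{P}$ is a maximal element of $\mathscr{C}(\Pi)$ if $\mathsf{P}\{\pi(Y)\le\alpha\}=\alpha$ for all $\alpha\in[0,1]$, where $Y\sim\mathsf{P}$.
   Formalization: Membership of Q_x in the credal set is proved in general; the equality Q_x{π_x(Θ) ≤ α} = α is proved when f(H,u_x) has no atoms given U = u_x, a necessary condition: it fails for X = θ + Unif(0,1), where π_x = 1 almost surely under Q_x. *)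

theory Defs
  imports "HOL-Probability.Probability"
begin

section \<open>Haar measure\<close>

text \<open>The library's class of topological groups that need not be commutative is written
  additively: below, \<open>g + h\<close> is the composition of \<open>g\<close> and \<open>h\<close>, \<open>- g\<close> the inverse of \<open>g\<close>,
  \<open>0\<close> the identity and \<open>g - h\<close> the composition of \<open>g\<close> with the inverse of \<open>h\<close>.\<close>

definition radon_measure :: "'a::t2_space measure \<Rightarrow> bool" where
  "radon_measure M \<longleftrightarrow>
     sets M = sets borel \<and>
     (\<forall>C. compact C \<longrightarrow> emeasure M C < \<infinity>) \<and>
     (\<forall>A\<in>sets borel. emeasure M A = (INF V\<in>{V. open V \<and> A \<subseteq> V}. emeasure M V)) \<and>
     (\<forall>V. open V \<longrightarrow> emeasure M V = (SUP C\<in>{C. compact C \<and> C \<subseteq> V}. emeasure M C))"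

definition left_haar :: "'g::{topological_group_add, t2_space} measure \<Rightarrow> bool" where
  "left_haar M \<longleftrightarrow> radon_measure M \<and> emeasure M UNIV \<noteq> 0 \<and>
     (\<forall>g. \<forall>A\<in>sets borel. emeasure M ((\<lambda>h. g + h) ` A) = emeasure M A)"

definition right_haar :: "'g::{topological_group_add, t2_space} measure \<Rightarrow> bool" where
  "right_haar M \<longleftrightarrow> radon_measure M \<and> emeasure M UNIV \<noteq> 0 \<and>
     (\<forall>g. \<forall>A\<in>sets borel. emeasure M ((\<lambda>h. h + g) ` A) = emeasure M A)"


section \<open>Conditional distributions\<close>

text \<open>\<open>K\<close> is a regular conditional distribution of the \<open>S\<close>-valued variable \<open>Y\<close> given the
  \<open>N\<close>-valued variable \<open>Z\<close>, under \<open>M\<close>.\<close>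

definition is_cond_distr ::
  "'a measure \<Rightarrow> ('a \<Rightarrow> 'b) \<Rightarrow> 'b measure \<Rightarrow> ('a \<Rightarrow> 'c) \<Rightarrow> 'c measure \<Rightarrow> ('c \<Rightarrow> 'b measure) \<Rightarrow> bool"
where
  "is_cond_distr M Y S Z N K \<longleftrightarrow>
     Y \<in> M \<rightarrow>\<^sub>M S \<and> Z \<in> M \<rightarrow>\<^sub>M N \<and> K \<in> N \<rightarrow>\<^sub>M prob_algebra S \<and>
     (\<forall>A\<in>sets S. \<forall>B\<in>sets N.
        emeasure M {w \<in> space M. Y w \<in> A \<and> Z w \<in> B} =
        (\<integral>\<^sup>+ w. emeasure (K (Z w)) A * indicator B (Z w) \<partial>M))"


section \<open>Possibility measures and credal sets\<close>

definition possibility :: "('y \<Rightarrow> real) \<Rightarrow> 'y set \<Rightarrow> ennreal" where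
  "possibility \<pi> A = (SUP y\<in>A. ennreal (\<pi> y))"

definition credal_set :: "'y measure \<Rightarrow> ('y set \<Rightarrow> ennreal) \<Rightarrow> 'y measure set" where
  "credal_set S Pl =
     {P. prob_space P \<and> sets P = sets S \<and> (\<forall>A\<in>sets S. emeasure P A \<le> Pl A)}"

definition maximal_in_credal_set :: "'y measure \<Rightarrow> ('y \<Rightarrow> real) \<Rightarrow> 'y measure \<Rightarrow> bool" where
  "maximal_in_credal_set S \<pi> P \<longleftrightarrow>
     P \<in> credal_set S (possibility \<pi>) \<and>
     (\<forall>\<alpha>\<in>{0..1}. measure P {y \<in> space P. \<pi> y \<le> \<alpha>} = \<alpha>)"


section \<open>Invariant statistical models\<close>

definition model_law :: "'x measure \<Rightarrow> ('g \<Rightarrow> 'x \<Rightarrow> real) \<Rightarrow> 'g \<Rightarrow> 'x measure" where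
  "model_law \<nu> p \<theta> = density \<nu> (\<lambda>x. ennreal (p \<theta> x))"

text \<open>The sample space is \<open>space \<nu>\<close> and the set of orbit labels is \<open>space \<mu>\<close>. The type \<open>'g\<close> is
  the group and, at the same time, the parameter space; the bijection of the parameter space
  induced by \<open>g\<close> is \<open>\<theta> \<mapsto> g + \<theta>\<close>. The measures \<open>L\<close> and \<open>R\<close> are the left and right Haar
  measures, \<open>t x\<close> is the pair of position and orbit coordinates of \<open>x\<close>, and \<open>q \<theta>\<close> is the joint
  density of \<open>t X\<close>. That two points have the same second coordinate iff they lie on the same
  orbit follows from \<open>t_bij\<close> and \<open>t_act\<close>.\<close>

locale invariant_model =
  fixes \<nu> :: "'x measure"
    and act :: "'g::{topological_group_add, t2_space} \<Rightarrow> 'x \<Rightarrow> 'x"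
    and p :: "'g \<Rightarrow> 'x \<Rightarrow> real"
    and jac :: "'g \<Rightarrow> real"
    and L R :: "'g measure"
    and \<mu> :: "'u measure"
    and t :: "'x \<Rightarrow> 'g \<times> 'u"
    and q :: "'g \<Rightarrow> 'g \<times> 'u \<Rightarrow> real"
  assumes locally_compact_group: "locally_compact_space (euclidean :: 'g topology)"
    and act_bij: "bij_betw (act g) (space \<nu>) (space \<nu>)"
    and act_comp: "x \<in> space \<nu> \<Longrightarrow> act (g + h) x = act g (act h x)"
    and act_faithful: "(\<And>x. x \<in> space \<nu> \<Longrightarrow> act g x = act h x) \<Longrightarrow> g = h"
    and sigma_finite_dominating: "sigma_finite_measure \<nu>"
    and p_measurable: "p \<theta> \<in> borel_measurable \<nu>"
    and p_nonneg: "x \<in> space \<nu> \<Longrightarrow> 0 \<le> p \<theta> x"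
    and prob_space_model: "prob_space (model_law \<nu> p \<theta>)"
    and multiplier_pos: "0 < jac g"
    and multiplier_hom: "jac (g + h) = jac g * jac h"
    and multiplier_jacobian: "A \<in> sets \<nu> \<Longrightarrow>
           act g ` A \<in> sets \<nu> \<and> emeasure \<nu> (act g ` A) = ennreal (jac g) * emeasure \<nu> A"
    and invariant: "x \<in> space \<nu> \<Longrightarrow> p \<theta> x = p (g + \<theta>) (act g x) * jac g"
    and left_haar_L: "left_haar L"
    and left_haar_unique: "left_haar M \<Longrightarrow> \<exists>c>0. M = scale_measure (ennreal c) L"
    and right_haar_R: "right_haar R"
    and right_haar_unique: "right_haar M \<Longrightarrow> \<exists>c>0. M = scale_measure (ennreal c) R"
    and t_bij: "bij_betw t (space \<nu>) (UNIV \<times> space \<mu>)"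
    and t_measurable: "t \<in> \<nu> \<rightarrow>\<^sub>M L \<Otimes>\<^sub>M \<mu>"
    and t_inverse_measurable: "the_inv_into (space \<nu>) t \<in> L \<Otimes>\<^sub>M \<mu> \<rightarrow>\<^sub>M \<nu>"
    and t_act: "x \<in> space \<nu> \<Longrightarrow> t (act g x) = (g + fst (t x), snd (t x))"
    and q_measurable: "q \<theta> \<in> borel_measurable (L \<Otimes>\<^sub>M \<mu>)"
    and q_nonneg: "z \<in> space (L \<Otimes>\<^sub>M \<mu>) \<Longrightarrow> 0 \<le> q \<theta> z"
    and joint_density: "distr (model_law \<nu> p \<theta>) (L \<Otimes>\<^sub>M \<mu>) t =
           density (L \<Otimes>\<^sub>M \<mu>) (\<lambda>z. ennreal (q \<theta> z))"

text \<open>The contour below depends on the version of the joint density and on the version of the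
  conditional distribution, so both are fixed here: \<open>f\<close> is the function with
  \<open>q \<theta> (g, u) = f (- \<theta> + g, u)\<close> almost everywhere, and \<open>K u\<close> is the conditional distribution of
  \<open>H = - \<theta> + G\<close> given \<open>U = u\<close> with density proportional to \<open>f (\<cdot>, u)\<close>, which determines \<open>K\<close>
  from \<open>f\<close>. Note that \<open>K\<close> does not depend on \<open>\<theta>\<close>.\<close>

locale invariant_model_cond = invariant_model \<nu> act p jac L R \<mu> t q
  for \<nu> :: "'x measure"
    and act :: "'g::{topological_group_add, t2_space} \<Rightarrow> 'x \<Rightarrow> 'x"
    and p :: "'g \<Rightarrow> 'x \<Rightarrow> real"
    and jac :: "'g \<Rightarrow> real"
    and L R :: "'g measure"
    and \<mu> :: "'u measure"
    and t :: "'x \<Rightarrow> 'g \<times> 'u"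
    and q :: "'g \<Rightarrow> 'g \<times> 'u \<Rightarrow> real" +
  fixes f :: "'g \<times> 'u \<Rightarrow> real"
    and K :: "'u \<Rightarrow> 'g measure"
  assumes f_measurable: "f \<in> borel_measurable (L \<Otimes>\<^sub>M \<mu>)"
    and f_nonneg: "z \<in> space (L \<Otimes>\<^sub>M \<mu>) \<Longrightarrow> 0 \<le> f z"
    and q_eq_f: "AE z in L \<Otimes>\<^sub>M \<mu>. q \<theta> z = f (- \<theta> + fst z, snd z)"
    and K_cond_distr:
      "is_cond_distr (model_law \<nu> p \<theta>) (\<lambda>x. - \<theta> + fst (t x)) L (\<lambda>x. snd (t x)) \<mu> K"
    and K_density: "u \<in> space \<mu> \<Longrightarrow>
      \<exists>c>0. K u = density L (\<lambda>h. ennreal (c * f (h, u)))"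


section \<open>Fiducial distribution and inferential model\<close>

definition fiducial ::
  "('x \<Rightarrow> 'g::{topological_group_add, t2_space} \<times> 'u) \<Rightarrow> ('u \<Rightarrow> 'g measure) \<Rightarrow> 'x \<Rightarrow> 'g measure"
where
  "fiducial t K x = (case t x of (g, u) \<Rightarrow> distr (K u) borel (\<lambda>h. g - h))"

definition contour ::
  "('x \<Rightarrow> 'g::{topological_group_add, t2_space} \<times> 'u) \<Rightarrow> ('g \<times> 'u \<Rightarrow> real) \<Rightarrow>
   ('u \<Rightarrow> 'g measure) \<Rightarrow> 'x \<Rightarrow> 'g \<Rightarrow> real"
where
  "contour t f K x \<theta> =
     (case t x of (g, u) \<Rightarrow> measure (K u) {h \<in> space (K u). f (h, u) \<le> f (- \<theta> + g, u)})"

end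

theory Submission
  imports Defs
begin

text \<open>
  Fix \<open>x\<close> with \<open>t x = (g, u)\<close>, write \<open>F h = f (h, u)\<close>, and let \<open>C\<close> be the distribution function
  of \<open>F H\<close>, where \<open>H \<sim> K u\<close>. The contour at \<open>\<theta>\<close> is by definition \<open>C (F (- \<theta> + g))\<close>. The
  fiducial variable is \<open>\<Theta> = g - H\<close>, and the substitution \<open>\<theta> = g - h\<close> undoes the one in the
  contour: \<open>- (g - h) + g = h\<close>. So the contour at \<open>\<Theta>\<close> is \<open>C (F H)\<close>, the probability integral
  transform of \<open>F H\<close>.

  Such a transform is stochastically no smaller than a uniform variable, whatever the law of
  \<open>F H\<close> (lemma \<open>prob_cdf_le\<close>). This gives membership in the credal set: an event \<open>A\<close>
  on which the contour has supremum \<open>s\<close> forces \<open>C (F H) \<le> s\<close>, which has probability at most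
  \<open>s\<close>. If moreover no level set of \<open>F\<close> has positive probability, then \<open>C\<close> is continuous and
  the transform is exactly uniform (lemma \<open>prob_cdf_le_eq\<close>), which is maximality.\<close>

text \<open>The sublevel set of a distribution function is a down-set of the line, so for
  \<open>s < 1\<close> it is empty or a proper half-line. A closed one has probability equal to a value of the distribution function, an open
  one to a left limit of values; in both cases the values are at most \<open>s\<close>.\<close>

lemma (in real_distribution) prob_cdf_le:
  assumes "0 \<le> s"
  shows "prob {y. cdf M y \<le> s} \<le> s"
proof (cases "s < 1")
  case False
  then show ?thesis using prob_le_1[of "{y. cdf M y \<le> s}"] by linarith
next
  case True
  define S where "S = {y. cdf M y \<le> s}"
  have down: "y \<in> S" if "z \<in> S" "y \<le> z" for y z
    using that cdf_nondecreasing[of y z] by (auto simp: S_def)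
  show ?thesis
  proof (cases "S = {}")
    case True
    then show ?thesis using assms unfolding S_def by simp
  next
    case False
    \<comment> \<open>As \<open>s < 1\<close> and the distribution function tends to 1, the half-line is proper.\<close>
    have "eventually (\<lambda>y. s < cdf M y) at_top"
      using order_tendstoD(1)[OF cdf_lim_at_top_prob \<open>s < 1\<close>] .
    then obtain b where "s < cdf M b"
      by (auto simp: eventually_at_top_linorder)
    then have b: "b \<notin> S" by (simp add: S_def)
    then have bdd: "bdd_above S"
      by (intro bdd_aboveI[of _ b]) (meson down linear)
    define z where "z = Sup S"
    have below: "y \<in> S" if "y < z" for y
      using that less_cSup_iff[OF False bdd] down by (fastforce simp: z_def)
    have above: "y \<le> z" if "y \<in> S" for y
      using cSup_upper[OF that bdd] by (simp add: z_def)
    show ?thesis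
    proof (cases "z \<in> S")
      case True
      then have "S = {..z}" using above down by auto
      then have "prob S = cdf M z" by (simp add: cdf_def)
      then show ?thesis using True by (simp add: S_def)
    next
      case False
      then have "S = {..<z}" using above below by (force simp: less_le)
      moreover have "prob {..<z} \<le> s"
      proof (rule tendsto_upperbound[OF cdf_at_left])
        show "eventually (\<lambda>y. cdf M y \<le> s) (at_left z)"
          unfolding eventually_at_left_field using below
          by (intro exI[of _ "z - 1"]) (auto simp: S_def)
      qed simp
      ultimately show ?thesis by (simp add: S_def)
    qed
  qed
qed

text \<open>Without atoms the distribution function is continuous and attains every level \<open>s\<close>
  strictly between 0 and 1, say at \<open>y\<close>. The half-line up to \<open>y\<close> then has probability \<open>s\<close> and
  lies in the sublevel set, which gives the inequality opposite to \<open>prob_cdf_le\<close>.\<close>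

lemma (in real_distribution) prob_cdf_le_eq:
  assumes no_atoms: "\<And>c. prob {c} = 0" and s: "0 \<le> s" "s \<le> 1"
  shows "prob {y. cdf M y \<le> s} = s"
proof (rule antisym[OF prob_cdf_le[OF s(1)]])
  consider "s = 0" | "s = 1" | "0 < s" "s < 1" using s by linarith
  then show "s \<le> prob {y. cdf M y \<le> s}"
  proof cases
    case 1
    then show ?thesis by simp
  next
    case 2
    then show ?thesis using prob_space by (simp add: cdf_bounded_prob)
  next
    case 3
    have "eventually (\<lambda>y. cdf M y < s) at_bot"
      using order_tendstoD(2)[OF cdf_lim_at_bot \<open>0 < s\<close>] .
    then obtain a where a: "\<And>y. y \<le> a \<Longrightarrow> cdf M y < s"
      by (auto simp: eventually_at_bot_linorder)
    have "eventually (\<lambda>y. s < cdf M y) at_top"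
      using order_tendstoD(1)[OF cdf_lim_at_top_prob \<open>s < 1\<close>] .
    then obtain b where b: "\<And>y. b \<le> y \<Longrightarrow> s < cdf M y"
      by (auto simp: eventually_at_top_linorder)
    have "a \<le> b" using a[of b] b[of b] by linarith
    moreover have "isCont (cdf M) y" for y using no_atoms by (simp add: isCont_cdf)
    ultimately obtain y where y: "cdf M y = s"
      using IVT[of "cdf M" a s b] a[of a] b[of b] by force
    have "s = prob {..y}" using y by (simp add: cdf_def)
    also have "\<dots> \<le> prob {y. cdf M y \<le> s}"
    proof (rule finite_measure_mono)
      show "{..y} \<subseteq> {y. cdf M y \<le> s}" using y cdf_nondecreasing[of _ y] by auto
      have "cdf M \<in> borel_measurable borel"
        by (intro borel_measurable_mono monoI cdf_nondecreasing)
      then show "{y. cdf M y \<le> s} \<in> sets M" by measurable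
    qed
    finally show ?thesis .
  qed
qed

text \<open>Measurability of the conditional density in its group argument is inherited from \<open>f\<close> by
  taking sections, and a conditional distribution is a probability measure at every orbit label,
  not just at almost every one; so the two facts hold at the label of every observation.\<close>

lemma (in invariant_model_cond) cond_distr_at_orbit:
  assumes "u \<in> space \<mu>"
  shows "prob_space (K u)" and "sets (K u) = sets borel"
    and "(\<lambda>h. f (h, u)) \<in> borel_measurable (K u)"
proof -
  have L: "sets L = sets borel"
    using left_haar_L by (simp add: left_haar_def radon_measure_def)
  have "K \<in> \<mu> \<rightarrow>\<^sub>M prob_algebra L"
    using K_cond_distr by (simp add: is_cond_distr_def)
  then have K: "K u \<in> space (prob_algebra L)"
    using assms by (rule measurable_space)
  then show "prob_space (K u)" by (simp add: space_prob_algebra)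
  have KL: "sets (K u) = sets L" using K by (simp add: space_prob_algebra)
  then show "sets (K u) = sets borel" using L by simp
  have "(\<lambda>h. f (h, u)) \<in> borel_measurable L"
    using assms by (intro measurable_compose[OF measurable_Pair2' f_measurable])
  then show "(\<lambda>h. f (h, u)) \<in> borel_measurable (K u)"
    by (simp cong: measurable_cong_sets add: KL)
qed

theorem theorem1:
  fixes \<nu> :: "'x measure"
    and act :: "'g::{topological_group_add, t2_space} \<Rightarrow> 'x \<Rightarrow> 'x"
    and p :: "'g \<Rightarrow> 'x \<Rightarrow> real"
    and jac :: "'g \<Rightarrow> real"
    and L R :: "'g measure"
    and \<mu> :: "'u measure"
    and t :: "'x \<Rightarrow> 'g \<times> 'u"
    and q :: "'g \<Rightarrow> 'g \<times> 'u \<Rightarrow> real"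
    and f :: "'g \<times> 'u \<Rightarrow> real"
    and K :: "'u \<Rightarrow> 'g measure"
    and x :: 'x
  assumes "invariant_model_cond \<nu> act p jac L R \<mu> t q f K"
    and "x \<in> space \<nu>"
  shows "fiducial t K x \<in> credal_set borel (possibility (contour t f K x)) \<and>
    ((\<forall>c. measure (K (snd (t x))) {h \<in> space (K (snd (t x))). f (h, snd (t x)) = c} = 0) \<longrightarrow>
      maximal_in_credal_set borel (contour t f K x) (fiducial t K x))"
proof -
  interpret invariant_model_cond \<nu> act p jac L R \<mu> t q f K by fact
  obtain g u where tx: "t x = (g, u)" by fastforce
  have u: "u \<in> space \<mu>"
    using bij_betwE[OF t_bij] assms(2) tx by fastforce
  define F where "F h = f (h, u)" for h
  define D where "D = distr (K u) borel F"
  interpret Ku: prob_space "K u" by (rule cond_distr_at_orbit(1)[OF u])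
  have setsK: "sets (K u) = sets borel" by (rule cond_distr_at_orbit(2)[OF u])
  have spaceK: "space (K u) = UNIV" using sets_eq_imp_space_eq[OF setsK] by simp
  have F: "F \<in> borel_measurable (K u)"
    unfolding F_def by (rule cond_distr_at_orbit(3)[OF u])
  interpret D: real_distribution D
    unfolding D_def by (rule Ku.real_distribution_distr[OF F])
  have cdf_borel: "cdf D \<in> borel_measurable borel"
    by (intro borel_measurable_mono monoI D.cdf_nondecreasing)
  have "(\<lambda>h. g - h) \<in> borel \<rightarrow>\<^sub>M borel"
    by (intro borel_measurable_continuous_onI continuous_intros)
  then have minus: "(\<lambda>h. g - h) \<in> K u \<rightarrow>\<^sub>M borel"
    by (simp cong: measurable_cong_sets add: setsK)

  have contour: "contour t f K x \<theta> = cdf D (F (- \<theta> + g))" for \<theta>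
    using F by (simp add: contour_def tx cdf_def D_def measure_distr F_def vimage_def spaceK)
  \<comment> \<open>The contour at the fiducial variable is the probability integral transform of \<open>F\<close>.\<close>
  have contour_minus: "contour t f K x (g - h) = cdf D (F h)" for h
    by (simp add: contour minus_diff_eq)
  have fid: "fiducial t K x = distr (K u) borel (\<lambda>h. g - h)"
    by (simp add: fiducial_def tx)
  have fid_prob: "prob_space (fiducial t K x)"
    unfolding fid by (rule Ku.prob_space_distr[OF minus])
  have fid_emeasure: "emeasure (fiducial t K x) A = emeasure (K u) {h. g - h \<in> A}"
    if "A \<in> sets borel" for A
    using that minus by (simp add: fid emeasure_distr vimage_def spaceK)
  have pit_sets: "{h. cdf D (F h) \<le> s} \<in> sets (K u)" for s
  proof -
    have "(\<lambda>h. cdf D (F h)) \<in> borel_measurable (K u)"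
      by (rule measurable_compose[OF F cdf_borel])
    from measurable_sets[OF this, of "{..s}"] show ?thesis
      by (simp add: vimage_def spaceK)
  qed
  have pit: "measure (K u) {h. cdf D (F h) \<le> s} = measure D {y. cdf D y \<le> s}" for s
  proof -
    have "{y. cdf D y \<le> s} \<in> sets borel" using cdf_borel by measurable
    then show ?thesis
      using F by (simp add: D_def measure_distr vimage_def spaceK)
  qed

  have in_credal: "fiducial t K x \<in> credal_set borel (possibility (contour t f K x))"
    unfolding credal_set_def
  proof (intro CollectI conjI ballI)
    fix A :: "'g set"
    assume A: "A \<in> sets borel"
    define s where "s = possibility (contour t f K x) A"
    have le_s: "ennreal (contour t f K x \<theta>) \<le> s" if "\<theta> \<in> A" for \<theta>
      using that by (auto simp: s_def possibility_def intro: SUP_upper)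
    have "s \<le> 1"
      unfolding s_def possibility_def
      by (rule SUP_least) (simp add: contour D.cdf_bounded_prob)
    then obtain r where r: "0 \<le> r" "s = ennreal r"
      by (cases s) (auto simp: top_unique)
    have "emeasure (K u) {h. g - h \<in> A} \<le> emeasure (K u) {h. cdf D (F h) \<le> r}"
    proof (rule emeasure_mono[OF _ pit_sets])
      show "{h. g - h \<in> A} \<subseteq> {h. cdf D (F h) \<le> r}"
        using le_s r by (auto simp: contour_minus[symmetric])
    qed
    also have "\<dots> \<le> ennreal r"
      using D.prob_cdf_le[OF r(1)] by (simp add: Ku.emeasure_eq_measure pit ennreal_leI)
    finally show "emeasure (fiducial t K x) A \<le> possibility (contour t f K x) A"
      using fid_emeasure[OF A] r(2) by (simp add: s_def)
  qed (use fid_prob fid in auto)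

  moreover have "maximal_in_credal_set borel (contour t f K x) (fiducial t K x)"
    if level: "\<And>c. measure (K u) {h \<in> space (K u). f (h, u) = c} = 0"
    unfolding maximal_in_credal_set_def
  proof (intro conjI ballI in_credal)
    fix \<alpha> :: real
    assume \<alpha>: "\<alpha> \<in> {0..1}"
    have "measure D {c} = 0" for c
      using level[of c] F by (simp add: D_def measure_distr vimage_def spaceK F_def)
    then have unif: "measure D {y. cdf D y \<le> \<alpha>} = \<alpha>"
      using \<alpha> by (intro D.prob_cdf_le_eq) auto
    \<comment> \<open>The contour itself is Borel: it is the transform of \<open>F\<close> after the homeomorphism
      \<open>\<theta> \<mapsto> - \<theta> + g\<close> of the group.\<close>
    have "(\<lambda>\<theta>. - \<theta> + g) \<in> borel \<rightarrow>\<^sub>M borel"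
      by (intro borel_measurable_continuous_onI continuous_intros)
    then have "(\<lambda>\<theta>. - \<theta> + g) -` {h. cdf D (F h) \<le> \<alpha>} \<inter> space borel \<in> sets borel"
      using pit_sets setsK by (intro measurable_sets) auto
    then have "{\<theta>. contour t f K x \<theta> \<le> \<alpha>} \<in> sets borel"
      by (simp add: contour vimage_def)
    then have "measure (fiducial t K x) {\<theta>. contour t f K x \<theta> \<le> \<alpha>} =
        measure (K u) {h. cdf D (F h) \<le> \<alpha>}"
      by (simp add: measure_def fid_emeasure contour_minus)
    then show "measure (fiducial t K x) {\<theta> \<in> space (fiducial t K x). contour t f K x \<theta> \<le> \<alpha>} = \<alpha>"
      using pit unif by (simp add: fid)
  qed
  ultimately show ?thesis by (simp add: tx)
qed

end
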